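(* Let $x(0)\in\mathbb{R}^n$ and let $x(k)$, $k\ge 0$, be the trajectory of $$x(k+1)=(I-\mathrm{diag}(\gamma(k))L)\,x(k)$$ started at $x(0)$, where the uncertain sequence $\gamma(k)\in\mathbb{R}^n$ satisfies $\underline{\gamma}_i\le\gamma_i(k)\le\overline{\gamma}_i$ for all $i\in V$ and all $k\ge 0$. Let $\alpha\in\mathbb{R}$ be the consensus value of this trajectory, i.e. $\lim_{k\to\infty}x_i(k)=\alpha$ for every $i\in V$. Let $\gamma_*$ and $\gamma^*$ be, respectively, a minimizer and a maximizer of $$\gamma\mapsto \frac{\nu^T\mathrm{diag}(1/\gamma)\,x(0)}{\nu^T\mathrm{diag}(1/\gamma)\mathbf{1}}$$ over all $\gamma$ with $\gamma_i\in[\underline{\gamma}_i,\overline{\gamma}_i]$ for $i\in V$, and set $$\underline{\nu}^T=\frac{\nu^T\mathrm{diag}(1/\gamma_* )}{\nu^T\mathrm{diag}(1/\gamma_* )\mathbf{1}},\qquad \overline{\nu}^T=\frac{\nu^T\mathrm{diag}(1/\gamma^* )}{\nu^T\mathrm{diag}(1/\gamma^* )\mathbf{1}}.$$ Assume that for all $k\ge 0$ $$\underline{\nu}^T\,\mathrm{diag}(\gamma(k))\,L\,x(k)\le 0\quad\text{and}\quad \overline{\nu}^T\,\mathrm{diag}(\gamma(k))\,L\,x(k)\ge 0 .$$ Then $\alpha_{\min}\le\alpha\le\alpha_{\max}$, where $$\alpha_{\min}=\underline{\nu}^Tx(0),\qquad \alpha_{\max}=\overline{\nu}^Tx(0).$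$
   Context: Setting: $V=\{1,\dots,n\}$, $n\ge 2$, is a set of agents interacting over a directed graph with weighted adjacency matrix $(a_{ij})$, $a_{ij}\in[0,1]$, $a_{ii}=0$. The graph is assumed strongly connected. $L$ is its Laplacian: $l_{ij}=-a_{ij}$ for $i\ne j$ and $l_{ii}=\sum_{j\ne i}a_{ij}$; by strong connectivity $0$ is a simple eigenvalue of $L$. $\nu\in\mathbb{R}^n$ is the unique vector with $\nu^TL=\mathbf{0}^T$ and $\nu^T\mathbf{1}=1$ (normalized left eigenvector for the eigenvalue $0$). For $i\in V$, $n_i$ is the number of neighbors of $i$, i.e. the number of $j\in V$ with $a_{ij}\neq 0$. Constants $0<\underline{\omega}\le\overline{\omega}\le 1$ are given, and $\underline{\gamma}_i=\underline{\omega}/n_i$, $\overline{\gamma}_i=\overline{\omega}/n_i$. Notation: $I$ is the identity matrix, $\mathbf{1}$ the column vector of ones, $\mathrm{diag}(\phi)$ the diagonal matrix with diagonal entries $\phi_i$, and for a vector $\gamma$ with positive entries $1/\gamma$ denotes the vector with entries $1/\gamma_i$. Componentwise, the dynamics read $x_i(k+1)=x_i(k)+\gamma_i(k)\sum_{j=1}^n a_{ij}(x_j(k)-x_i(k))$. *)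

theory Defs
  imports "HOL-Analysis.Analysis" "Graph_Theory.Digraph_Component"
begin

text \<open>Agents are the elements of a finite type. Entry \<open>a $ i $ j\<close> is the weight with which
  agent \<open>i\<close> takes agent \<open>j\<close> into account. We draw the arc from \<open>i\<close> to \<open>j\<close>; the opposite
  convention reverses all arcs, which does not affect strong connectivity.\<close>

definition interaction_graph :: "real ^ 'n ^ 'n \<Rightarrow> 'n pair_pre_digraph" where
  "interaction_graph a = \<lparr> pverts = UNIV, parcs = {(i, j). a $ i $ j \<noteq> 0} \<rparr>"

definition laplacian :: "real ^ 'n ^ 'n \<Rightarrow> real ^ 'n ^ 'n" where
  "laplacian a = (\<chi> i j. if i = j then (\<Sum>m\<in>UNIV - {i}. a $ i $ m) else - a $ i $ j)"

definition num_neighbors :: "real ^ 'n ^ 'n \<Rightarrow> 'n \<Rightarrow> nat" where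
  "num_neighbors a i = card {j. a $ i $ j \<noteq> 0}"

definition gain_bound :: "real \<Rightarrow> real ^ 'n ^ 'n \<Rightarrow> real ^ 'n" where
  "gain_bound \<omega> a = (\<chi> i. \<omega> / real (num_neighbors a i))"

definition diag :: "real ^ 'n \<Rightarrow> real ^ 'n ^ 'n" where
  "diag \<phi> = (\<chi> i j. if i = j then \<phi> $ i else 0)"

definition vec_recip :: "real ^ 'n \<Rightarrow> real ^ 'n" where
  "vec_recip \<gamma> = (\<chi> i. 1 / \<gamma> $ i)"

text \<open>Here \<open>1\<close> is the all-ones vector, and \<open>v v* A\<close> is the row vector given by \<open>v\<close> transposed
  times \<open>A\<close>.\<close>

definition consensus_ratio :: "real ^ 'n \<Rightarrow> real ^ 'n \<Rightarrow> real ^ 'n \<Rightarrow> real" where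
  "consensus_ratio \<nu> x0 \<gamma> =
     ((\<nu> v* diag (vec_recip \<gamma>)) \<bullet> x0) / ((\<nu> v* diag (vec_recip \<gamma>)) \<bullet> 1)"

definition scaled_left_eigenvector :: "real ^ 'n \<Rightarrow> real ^ 'n \<Rightarrow> real ^ 'n" where
  "scaled_left_eigenvector \<nu> \<gamma> =
     (1 / ((\<nu> v* diag (vec_recip \<gamma>)) \<bullet> 1)) *\<^sub>R (\<nu> v* diag (vec_recip \<gamma>))"

end

theory Submission
  imports Defs
begin

text \<open>Along a trajectory, \<open>\<nu>_lo \<bullet> x k\<close> is nondecreasing and \<open>\<nu>_hi \<bullet> x k\<close> is nonincreasing, by the
  two sign conditions. Their limits are \<open>\<alpha>\<close> times the coordinate sums of \<open>\<nu>_lo\<close> and \<open>\<nu>_hi\<close>, and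
  these sums are 1 as soon as the normalizing denominators do not vanish. For the latter it
  suffices that \<open>\<nu>\<close> is nonnegative. Taking absolute values in \<open>\<nu> v* laplacian a = 0\<close> and summing
  over the vertices shows that \<open>\<bar>\<nu>\<bar>\<close> is again a left null vector, and so is the nonnegative vector
  \<open>\<bar>\<nu>\<bar> - \<nu>\<close>. By strong connectivity the latter is either positive everywhere, which contradicts
  \<open>\<nu> \<bullet> 1 = 1\<close>, or identically zero.\<close>

text \<open>Adding \<open>v $ j * a $ j $ j\<close> to both sums lets them range over all of
  \<open>UNIV\<close>, so later arguments need no case split on the diagonal.\<close>

lemma vector_matrix_mult_laplacian_nth:
  "(v v* laplacian a) $ j = v $ j * (\<Sum>m\<in>UNIV. a $ j $ m) - (\<Sum>i\<in>UNIV. v $ i * a $ i $ j)"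
proof -
  have "(v v* laplacian a) $ j =
      v $ j * (\<Sum>m\<in>UNIV - {j}. a $ j $ m) + (\<Sum>i\<in>UNIV - {j}. - (v $ i * a $ i $ j))"
    by (subst sum.cong[OF refl, of "UNIV - {j}" _ "\<lambda>i. v $ i * laplacian a $ i $ j"])
       (auto simp: vector_matrix_mult_def laplacian_def sum.remove[of UNIV j] mult.commute)
  then show ?thesis
    by (simp add: sum.remove[of UNIV j] sum_negf algebra_simps)
qed

lemma left_null_laplacian_iff:
  "v v* laplacian a = 0 \<longleftrightarrow>
    (\<forall>j. v $ j * (\<Sum>m\<in>UNIV. a $ j $ m) = (\<Sum>i\<in>UNIV. v $ i * a $ i $ j))"
  by (simp add: vec_eq_iff vector_matrix_mult_laplacian_nth)

lemma vector_matrix_mult_diag: "v v* diag \<phi> = (\<chi> i. v $ i * \<phi> $ i)"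
  by (simp add: vec_eq_iff vector_matrix_mult_def diag_def if_distrib cong: if_cong)

lemma strongly_connected_arcs:
  assumes "strongly_connected (with_proj (interaction_graph a))"
  shows "(i, j) \<in> {(i, j). a $ i $ j \<noteq> 0}\<^sup>*"
  using assms reachable_rtranclI[of "with_proj (interaction_graph a)" i j]
  by (auto simp: strongly_connected_def interaction_graph_def)

text \<open>A path from \<open>i\<close> to a second vertex starts with an arc leaving
  \<open>i\<close>. This keeps the gain bounds from being divisions by zero.\<close>

lemma num_neighbors_pos:
  assumes "strongly_connected (with_proj (interaction_graph (a :: real ^ 'n ^ 'n)))"
    and "CARD('n) \<ge> 2"
  shows "num_neighbors a i > 0"
proof -
  have "UNIV \<noteq> {i}"
    using assms(2) by (metis card_1_singleton_iff One_nat_def Suc_1 not_less_eq_eq order_refl)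
  then obtain j where "j \<noteq> i" by blast
  with strongly_connected_arcs[OF assms(1), of i j] obtain k where "a $ i $ k \<noteq> 0"
    by (metis (mono_tags, lifting) case_prodD converse_rtranclE mem_Collect_eq)
  then show ?thesis
    by (auto simp: num_neighbors_def card_gt_0_iff)
qed

lemma abs_left_null_laplacian:
  fixes a :: "real ^ 'n ^ 'n"
  assumes nonneg: "\<And>i j. 0 \<le> a $ i $ j" and null: "v v* laplacian a = 0"
  shows "(\<chi> i. \<bar>v $ i\<bar>) v* laplacian a = 0"
proof -
  \<comment> \<open>\<open>defect j\<close> is minus entry \<open>j\<close> of the row vector
    \<bar>v\<bar> times the Laplacian; the triangle inequality makes it nonnegative.\<close>
  define defect where
    "defect j = (\<Sum>i\<in>UNIV. \<bar>v $ i\<bar> * a $ i $ j) - \<bar>v $ j\<bar> * (\<Sum>m\<in>UNIV. a $ j $ m)" for j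
  have "defect j \<ge> 0" for j
  proof -
    have "\<bar>v $ j\<bar> * (\<Sum>m\<in>UNIV. a $ j $ m) = \<bar>v $ j * (\<Sum>m\<in>UNIV. a $ j $ m)\<bar>"
      by (simp add: abs_mult sum_nonneg nonneg)
    also have "\<dots> = \<bar>\<Sum>i\<in>UNIV. v $ i * a $ i $ j\<bar>"
      using null by (simp add: left_null_laplacian_iff)
    also have "\<dots> \<le> (\<Sum>i\<in>UNIV. \<bar>v $ i\<bar> * a $ i $ j)"
      using sum_abs[of "\<lambda>i. v $ i * a $ i $ j" UNIV] by (simp add: abs_mult nonneg)
    finally show ?thesis by (simp add: defect_def)
  qed
  \<comment> \<open>Rows of the Laplacian sum to zero: after swapping, both double sums run over the
    same terms.\<close>
  moreover have "sum defect UNIV = 0"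
    unfolding defect_def sum_subtractf
    by (subst sum.swap) (simp add: sum_distrib_left)
  ultimately have "defect j = 0" for j
    by (simp add: sum_nonneg_eq_0_iff)
  then show ?thesis
    by (simp add: left_null_laplacian_iff defect_def)
qed

text \<open>Zeros spread backwards along arcs: where \<open>u $ q = 0\<close>, the null equation at
  \<open>q\<close> is a vanishing sum of nonnegative terms, so \<open>u\<close> vanishes at the tail
  of every arc into \<open>q\<close>.\<close>

lemma nonneg_left_null_laplacian_eq_0:
  fixes a :: "real ^ 'n ^ 'n"
  assumes nonneg: "\<And>i j. 0 \<le> a $ i $ j"
    and conn: "strongly_connected (with_proj (interaction_graph a))"
    and null: "u v* laplacian a = 0" and u: "\<And>i. 0 \<le> u $ i" and zero: "u $ j = 0"
  shows "u = 0"
proof -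
  have step: "u $ p = 0" if "u $ q = 0" "a $ p $ q \<noteq> 0" for p q
  proof -
    have "(\<Sum>i\<in>UNIV. u $ i * a $ i $ q) = 0"
      using null that(1) by (metis left_null_laplacian_iff mult_zero_left)
    then have "u $ p * a $ p $ q = 0"
      by (simp add: sum_nonneg_eq_0_iff u nonneg)
    with that(2) show ?thesis by simp
  qed
  have "u $ i = 0" for i
    using strongly_connected_arcs[OF conn, of i j]
    by (induction rule: converse_rtrancl_induct) (use zero in \<open>auto intro: step\<close>)
  then show ?thesis by (simp add: vec_eq_iff)
qed

lemma normalized_left_null_laplacian_nonneg:
  fixes a :: "real ^ 'n ^ 'n"
  assumes nonneg: "\<And>i j. 0 \<le> a $ i $ j"
    and conn: "strongly_connected (with_proj (interaction_graph a))"
    and null: "\<nu> v* laplacian a = 0" and norm: "\<nu> \<bullet> 1 = 1"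
  shows "0 \<le> \<nu> $ i"
proof -
  define u where "u = (\<chi> i. \<bar>\<nu> $ i\<bar>) - \<nu>"
  have u_null: "u v* laplacian a = 0"
    using abs_left_null_laplacian[OF nonneg null] null
    by (simp add: u_def vector_matrix_mult_diff_distrib)
  \<comment> \<open>At a positive entry of \<nu> the vector \<open>u\<close> has the zero from which
    it vanishes everywhere.\<close>
  obtain j where "\<nu> $ j > 0"
  proof (rule ccontr)
    assume "\<not> thesis"
    with that have "\<nu> $ j \<le> 0" for j by (meson not_less)
    then have "\<nu> \<bullet> 1 \<le> 0" by (simp add: inner_vec_def sum_nonpos)
    with norm show False by simp
  qed
  then have "u = 0"
    by (intro nonneg_left_null_laplacian_eq_0[OF nonneg conn u_null, of j]) (auto simp: u_def)
  then have "u $ i = 0" by simp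
  then show ?thesis by (simp add: u_def)
qed

text \<open>The denominator is a sum of nonnegative terms; if it were zero, all entries of \<nu>
  would be zero.\<close>

lemma scaled_left_eigenvector_sum:
  assumes "\<And>i. 0 \<le> \<nu> $ i" and "\<nu> \<bullet> 1 = 1" and "\<And>i. 0 < g $ i"
  shows "scaled_left_eigenvector \<nu> g \<bullet> 1 = 1"
proof -
  have "(\<Sum>i\<in>UNIV. \<nu> $ i / g $ i) \<noteq> 0"
  proof
    assume "(\<Sum>i\<in>UNIV. \<nu> $ i / g $ i) = 0"
    then have "\<nu> $ i / g $ i = 0" for i
      by (simp add: sum_nonneg_eq_0_iff assms(1) less_imp_le[OF assms(3)])
    then have "\<nu> $ i = 0" for i
      using assms(3)[of i] by (metis divide_eq_0_iff less_irrefl)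
    then show False using assms(2) by (simp add: inner_vec_def)
  qed
  then have "(\<nu> v* diag (vec_recip g)) \<bullet> 1 \<noteq> 0"
    by (simp add: vector_matrix_mult_diag vec_recip_def inner_vec_def)
  then show ?thesis
    by (simp add: scaled_left_eigenvector_def)
qed

lemma weighted_sum_le_consensus:
  fixes x :: "nat \<Rightarrow> real ^ 'n"
  assumes step: "\<And>k. x (Suc k) = (mat 1 - diag (\<gamma> k) ** L) *v x k"
    and lim: "\<And>i. (\<lambda>k. x k $ i) \<longlonglongrightarrow> \<alpha>"
    and w: "w \<bullet> 1 = 1" and sign: "\<And>k. (w v* diag (\<gamma> k) v* L) \<bullet> x k \<le> 0"
  shows "w \<bullet> x 0 \<le> \<alpha>"
proof (rule incseq_le[of "\<lambda>k. w \<bullet> x k"])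
  \<comment> \<open>Moving the matrices onto \<open>w\<close> turns the increment into minus the
    quantity in \<open>sign\<close>.\<close>
  have "w \<bullet> x (Suc k) = w \<bullet> x k - (w v* diag (\<gamma> k) v* L) \<bullet> x k" for k
    by (simp add: step matrix_vector_mult_diff_rdistrib inner_diff_right dot_lmul_matrix
        matrix_vector_mul_assoc)
  then show "incseq (\<lambda>k. w \<bullet> x k)"
    using sign by (intro incseq_SucI) simp
  have "(\<lambda>k. w \<bullet> x k) \<longlonglongrightarrow> (\<Sum>i\<in>UNIV. w $ i * \<alpha>)"
    unfolding inner_vec_def inner_real_def by (intro tendsto_intros lim)
  also have "(\<Sum>i\<in>UNIV. w $ i * \<alpha>) = \<alpha>"
    using w by (simp add: inner_vec_def flip: sum_distrib_right)
  finally show "(\<lambda>k. w \<bullet> x k) \<longlonglongrightarrow> \<alpha>" .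
qed

theorem theorem1:
  fixes a :: "real ^ 'n ^ 'n"
    and \<nu> \<gamma>_min \<gamma>_max \<nu>_lo \<nu>_hi :: "real ^ 'n"
    and \<omega>_lo \<omega>_hi \<alpha> \<alpha>_min \<alpha>_max :: real
    and \<gamma> x :: "nat \<Rightarrow> real ^ 'n"
  assumes "CARD('n) \<ge> 2"
    and "\<And>i j. 0 \<le> a $ i $ j \<and> a $ i $ j \<le> 1"
    and "\<And>i. a $ i $ i = 0"
    and "strongly_connected (with_proj (interaction_graph a))"
    and "\<nu> v* laplacian a = 0"
    and "\<nu> \<bullet> 1 = 1"
    and "0 < \<omega>_lo" and "\<omega>_lo \<le> \<omega>_hi" and "\<omega>_hi \<le> 1"
    and "\<And>k i. gain_bound \<omega>_lo a $ i \<le> \<gamma> k $ i \<and> \<gamma> k $ i \<le> gain_bound \<omega>_hi a $ i"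
    and "\<And>k. x (Suc k) = (mat 1 - diag (\<gamma> k) ** laplacian a) *v x k"
    and "\<And>i. (\<lambda>k. x k $ i) \<longlonglongrightarrow> \<alpha>"
    and "is_arg_min (consensus_ratio \<nu> (x 0))
           (\<lambda>g. \<forall>i. gain_bound \<omega>_lo a $ i \<le> g $ i \<and> g $ i \<le> gain_bound \<omega>_hi a $ i) \<gamma>_min"
    and "is_arg_max (consensus_ratio \<nu> (x 0))
           (\<lambda>g. \<forall>i. gain_bound \<omega>_lo a $ i \<le> g $ i \<and> g $ i \<le> gain_bound \<omega>_hi a $ i) \<gamma>_max"
    and "\<nu>_lo = scaled_left_eigenvector \<nu> \<gamma>_min"
    and "\<nu>_hi = scaled_left_eigenvector \<nu> \<gamma>_max"
    and "\<And>k. (\<nu>_lo v* diag (\<gamma> k) v* laplacian a) \<bullet> x k \<le> 0"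
    and "\<And>k. (\<nu>_hi v* diag (\<gamma> k) v* laplacian a) \<bullet> x k \<ge> 0"
    and "\<alpha>_min = \<nu>_lo \<bullet> x 0"
    and "\<alpha>_max = \<nu>_hi \<bullet> x 0"
  shows "\<alpha>_min \<le> \<alpha> \<and> \<alpha> \<le> \<alpha>_max"
proof -
  note step = assms(11) and lim = assms(12)
  \<comment> \<open>Both optimizers are feasible, so this lower bound makes their entries
    positive.\<close>
  have gain_pos: "0 < gain_bound \<omega>_lo a $ i" for i
    using num_neighbors_pos[OF assms(4,1)] assms(7) by (simp add: gain_bound_def)
  have \<nu>_nonneg: "0 \<le> \<nu> $ i" for i
    using normalized_left_null_laplacian_nonneg[OF _ assms(4-6)] assms(2) by blast
  have "0 < \<gamma>_min $ i" for i
    using assms(13) gain_pos[of i] by (auto simp: is_arg_min_def intro: less_le_trans)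
  then have lo_sum: "\<nu>_lo \<bullet> 1 = 1"
    unfolding assms(15) by (intro scaled_left_eigenvector_sum \<nu>_nonneg assms(6))
  have "0 < \<gamma>_max $ i" for i
    using assms(14) gain_pos[of i] by (auto simp: is_arg_max_def intro: less_le_trans)
  then have hi_sum: "\<nu>_hi \<bullet> 1 = 1"
    unfolding assms(16) by (intro scaled_left_eigenvector_sum \<nu>_nonneg assms(6))
  have "\<nu>_lo \<bullet> x 0 \<le> \<alpha>"
    by (rule weighted_sum_le_consensus[OF step lim lo_sum assms(17)])
  \<comment> \<open>The recursion is linear, so the negated trajectory obeys it too, with limit
    -\<alpha> and reversed sign condition.\<close>
  moreover have "\<nu>_hi \<bullet> (- x 0) \<le> - \<alpha>"
  proof (rule weighted_sum_le_consensus[where x = "\<lambda>k. - x k"])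
    show "- x (Suc k) = (mat 1 - diag (\<gamma> k) ** laplacian a) *v (- x k)" for k
      by (simp add: step linear_neg[OF matrix_vector_mul_linear])
    show "(\<lambda>k. (- x k) $ i) \<longlonglongrightarrow> - \<alpha>" for i
      using tendsto_minus[OF lim[of i]] by simp
    show "(\<nu>_hi v* diag (\<gamma> k) v* laplacian a) \<bullet> (- x k) \<le> 0" for k
      using assms(18)[of k] by simp
  qed (fact hi_sum)
  ultimately show ?thesis
    by (simp add: assms(19,20))
qed

end
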